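(* Let $k$ be an algebraically closed field of characteristic $p=2$, let $q>3$ be an odd integer, and let $\Gamma=D_{2q}\times C_2$, where $D_{2q}$ is the dihedral group of order $2q$ and $C_2$ is the cyclic group of order $2$. Let $\Gamma_2$ be a Sylow $2$-subgroup of $\Gamma$. Then there is an action of $\Gamma$ by group automorphisms on a connected unipotent group $V$ over $k$ such that the restriction map $$\Theta\colon \mathrm{H}^1(\Gamma,V)\to \mathrm{H}^1(\Gamma_2,V)$$ has an infinite fibre.
   Context: A unipotent group over $k$ means a unipotent linear algebraic group over $k$, identified with its group of $k$-points; connected means connected in the Zariski topology. Let a finite group $\Delta$ act on a (not necessarily abelian) group $V$ by group automorphisms, written $\gamma\cdot v$. A $1$-cocycle is a function $\theta\colon\Delta\to V$ such that $\theta(\gamma_1\gamma_2)=\theta(\gamma_1)\,(\gamma_1\cdot\theta(\gamma_2))$ for all $\gamma_1,\gamma_2\in\Delta$; the set of these is $\mathrm{Z}^1(\Delta,V)$. Two $1$-cocycles $\theta,\theta'$ are equivalent if there is $v\in V$ with $\theta'(\gamma)=v\,\theta(\gamma)\,(\gamma\cdot v^{-1})$ for all $\gamma\in\Delta$. The nonabelian $1$-cohomology $\mathrm{H}^1(\Delta,V)$ is the set of equivalence classes of $1$-cocycles. The subgroup $\Gamma_2$ acts on $V$ by restriction of the action of $\Gamma$, and $\Theta$ is the map induced by restricting $1$-cocycles from $\Gamma$ to $\Gamma_2$. *)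

theory Defs
  imports
    "HOL-Analysis.Abstract_Topology"
    "HOL-Algebra.Elementary_Groups"
    "HOL-Algebra.Bij"
    "HOL-Computational_Algebra.Primes"
    "Jordan_Normal_Form.Matrix"
    "Jordan_Normal_Form.Determinant"
begin

section \<open>Linear algebraic groups\<close>

abbreviation GL :: "nat \<Rightarrow> 'k::field mat monoid"
  where "GL n \<equiv> units_of (ring_mat TYPE('k) n ())"

text \<open>The functions induced by the coordinate ring \<open>k[GL\<^sub>n] = k[x\<^sub>i\<^sub>j, 1/det]\<close>.\<close>

inductive_set regular_functions :: "nat \<Rightarrow> ('k::field mat \<Rightarrow> 'k) set"
  for n :: nat
  where
    const: "(\<lambda>A. c) \<in> regular_functions n"
  | entry: "i < n \<Longrightarrow> j < n \<Longrightarrow> (\<lambda>A. A $$ (i, j)) \<in> regular_functions n"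
  | inverse_det: "(\<lambda>A. inverse (det A)) \<in> regular_functions n"
  | add: "f \<in> regular_functions n \<Longrightarrow> g \<in> regular_functions n
      \<Longrightarrow> (\<lambda>A. f A + g A) \<in> regular_functions n"
  | mult: "f \<in> regular_functions n \<Longrightarrow> g \<in> regular_functions n
      \<Longrightarrow> (\<lambda>A. f A * g A) \<in> regular_functions n"

definition zero_locus :: "nat \<Rightarrow> ('k::field mat \<Rightarrow> 'k) set \<Rightarrow> 'k mat set"
  where "zero_locus n F = {A \<in> carrier (GL n). \<forall>f\<in>F. f A = 0}"

definition zariski :: "nat \<Rightarrow> 'k::field mat topology"
  where "zariski n =
    topology (\<lambda>U. \<exists>F \<subseteq> regular_functions n. U = carrier (GL n) - zero_locus n F)"

lemma istopology_zariski:
  "istopology (\<lambda>U. \<exists>F \<subseteq> regular_functions n. U = carrier (GL n :: 'k::field mat monoid) - zero_locus n F)"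
  unfolding istopology_def
proof (intro conjI allI impI)
  fix U V :: "'k mat set"
  assume "\<exists>F\<subseteq>regular_functions n. U = carrier (GL n) - zero_locus n F"
    and "\<exists>F\<subseteq>regular_functions n. V = carrier (GL n) - zero_locus n F"
  then obtain F G where F: "F \<subseteq> regular_functions n" "U = carrier (GL n) - zero_locus n F"
    and G: "G \<subseteq> regular_functions n" "V = carrier (GL n) - zero_locus n G" by blast
  let ?H = "(\<lambda>(f, g) A. f A * g A) ` (F \<times> G)"
  have "?H \<subseteq> regular_functions n"
  proof (rule image_subsetI)
    fix fg assume "fg \<in> F \<times> G"
    then show "(\<lambda>(f, g) A. f A * g A) fg \<in> regular_functions n"
      using F(1) G(1) by (cases fg) (simp add: regular_functions.mult subset_iff)
  qed
  moreover have "U \<inter> V = carrier (GL n) - zero_locus n ?H"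
  proof (rule Set.set_eqI)
    fix A
    have "(\<forall>h\<in>?H. h A = 0) \<longleftrightarrow> (\<forall>f\<in>F. \<forall>g\<in>G. f A * g A = 0)"
      by (simp add: image_iff split_beta)
    also have "\<dots> \<longleftrightarrow> (\<forall>f\<in>F. f A = 0) \<or> (\<forall>g\<in>G. g A = 0)" by auto
    finally show "A \<in> U \<inter> V \<longleftrightarrow> A \<in> carrier (GL n) - zero_locus n ?H"
      unfolding F(2) G(2) zero_locus_def by blast
  qed
  ultimately show "\<exists>F\<subseteq>regular_functions n. U \<inter> V = carrier (GL n) - zero_locus n F"
    by blast
next
  fix \<U> :: "'k mat set set"
  assume "\<forall>U\<in>\<U>. \<exists>F\<subseteq>regular_functions n. U = carrier (GL n) - zero_locus n F"
  then obtain F where F: "\<And>U. U \<in> \<U> \<Longrightarrow> F U \<subseteq> regular_functions n"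
    "\<And>U. U \<in> \<U> \<Longrightarrow> U = carrier (GL n) - zero_locus n (F U)" by metis
  have "\<Union>\<U> = carrier (GL n) - zero_locus n (\<Union>(F ` \<U>))"
  proof (rule Set.set_eqI)
    fix A
    have "A \<in> \<Union>\<U> \<longleftrightarrow> (\<exists>U\<in>\<U>. A \<in> carrier (GL n) - zero_locus n (F U))"
      unfolding Union_iff by (rule bex_cong[OF refl]) (use F(2) in blast)
    also have "\<dots> \<longleftrightarrow> A \<in> carrier (GL n) - zero_locus n (\<Union>(F ` \<U>))"
      unfolding zero_locus_def by auto
    finally show "A \<in> \<Union>\<U> \<longleftrightarrow> A \<in> carrier (GL n) - zero_locus n (\<Union>(F ` \<U>))" .
  qed
  moreover have "\<Union>(F ` \<U>) \<subseteq> regular_functions n"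
    by (rule UN_least) (rule F(1))
  ultimately show "\<exists>F\<subseteq>regular_functions n. \<Union>\<U> = carrier (GL n) - zero_locus n F"
    by (intro exI conjI)
qed

lemma openin_zariski:
  "openin (zariski n) U \<longleftrightarrow> (\<exists>F \<subseteq> regular_functions n. U = carrier (GL n) - zero_locus n F)"
  unfolding zariski_def by (simp only: topology_inverse'[OF istopology_zariski])

lemma topspace_zariski [simp]: "topspace (zariski n) = carrier (GL n)"
proof
  show "topspace (zariski n) \<subseteq> carrier (GL n)"
    unfolding topspace_def openin_zariski by blast
  have "carrier (GL n :: 'a mat monoid) = carrier (GL n) - zero_locus n {\<lambda>A. 1}"
    by (auto simp: zero_locus_def)
  then have "openin (zariski n) (carrier (GL n :: 'a mat monoid))"
    unfolding openin_zariski
    by (intro exI[of _ "{\<lambda>A. 1}"] conjI) (simp_all only: insert_subset empty_subsetI regular_functions.const)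
  then show "carrier (GL n) \<subseteq> topspace (zariski n :: 'a mat topology)"
    by (rule openin_subset)
qed

lemma closedin_zariski:
  "closedin (zariski n) V \<longleftrightarrow> (\<exists>F \<subseteq> regular_functions n. V = zero_locus n F)"
proof -
  have sub: "zero_locus n F \<subseteq> carrier (GL n)" for F :: "('a mat \<Rightarrow> 'a) set"
    by (auto simp: zero_locus_def)
  have eq: "V = zero_locus n F \<longleftrightarrow>
      V \<subseteq> carrier (GL n) \<and> carrier (GL n) - V = carrier (GL n) - zero_locus n F" for F
    using sub[of F] by blast
  show ?thesis
    unfolding closedin_def openin_zariski topspace_zariski eq by (rule iffI; elim conjE exE; intro conjI exI; assumption)
qed

definition linear_algebraic_group :: "nat \<Rightarrow> 'k::field mat set \<Rightarrow> bool"
  where "linear_algebraic_group n V \<longleftrightarrow> subgroup V (GL n) \<and> closedin (zariski n) V"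

definition unipotent_mat :: "nat \<Rightarrow> 'k::field mat \<Rightarrow> bool"
  where "unipotent_mat n A \<longleftrightarrow> (\<exists>m. (A - 1\<^sub>m n) ^\<^sub>m m = 0\<^sub>m n n)"

definition unipotent_group :: "nat \<Rightarrow> 'k::field mat set \<Rightarrow> bool"
  where "unipotent_group n V \<longleftrightarrow> linear_algebraic_group n V \<and> (\<forall>A\<in>V. unipotent_mat n A)"

text \<open>Since a closed subgroup \<open>V\<close> of \<open>GL\<^sub>n\<close> is a closed subset of an affine variety, its regular
  functions are the restrictions of those of \<open>GL\<^sub>n\<close>; so this says that the coordinates of \<open>f\<close> are
  regular on \<open>V\<close>.\<close>

definition regular_map :: "nat \<Rightarrow> 'k::field mat set \<Rightarrow> ('k mat \<Rightarrow> 'k mat) \<Rightarrow> bool"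
  where "regular_map n V f \<longleftrightarrow>
    (\<forall>i<n. \<forall>j<n. \<exists>g\<in>regular_functions n. \<forall>A\<in>V. f A $$ (i, j) = g A)"


section \<open>Actions and nonabelian 1-cohomology\<close>

definition acts_by_automorphisms ::
    "('g, 'a) monoid_scheme \<Rightarrow> ('v, 'b) monoid_scheme \<Rightarrow> ('g \<Rightarrow> 'v \<Rightarrow> 'v) \<Rightarrow> bool"
  where "acts_by_automorphisms \<Delta> V \<phi> \<longleftrightarrow> group_hom \<Delta> (AutoGroup V) \<phi>"

text \<open>Cocycles are taken extensional, so that they are determined by their values on the group.\<close>

definition Z1 :: "('g, 'a) monoid_scheme \<Rightarrow> ('v, 'b) monoid_scheme \<Rightarrow> ('g \<Rightarrow> 'v \<Rightarrow> 'v) \<Rightarrow> ('g \<Rightarrow> 'v) set"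
  where "Z1 \<Delta> V \<phi> = {\<theta> \<in> carrier \<Delta> \<rightarrow>\<^sub>E carrier V.
    \<forall>\<gamma>\<^sub>1\<in>carrier \<Delta>. \<forall>\<gamma>\<^sub>2\<in>carrier \<Delta>. \<theta> (\<gamma>\<^sub>1 \<otimes>\<^bsub>\<Delta>\<^esub> \<gamma>\<^sub>2) = \<theta> \<gamma>\<^sub>1 \<otimes>\<^bsub>V\<^esub> \<phi> \<gamma>\<^sub>1 (\<theta> \<gamma>\<^sub>2)}"

definition cocycle_rel ::
    "('g, 'a) monoid_scheme \<Rightarrow> ('v, 'b) monoid_scheme \<Rightarrow> ('g \<Rightarrow> 'v \<Rightarrow> 'v) \<Rightarrow> ('g \<Rightarrow> 'v) rel"
  where "cocycle_rel \<Delta> V \<phi> = {(\<theta>, \<theta>'). \<theta> \<in> Z1 \<Delta> V \<phi> \<and> \<theta>' \<in> Z1 \<Delta> V \<phi> \<and>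
    (\<exists>v\<in>carrier V. \<forall>\<gamma>\<in>carrier \<Delta>. \<theta>' \<gamma> = v \<otimes>\<^bsub>V\<^esub> \<theta> \<gamma> \<otimes>\<^bsub>V\<^esub> \<phi> \<gamma> (inv\<^bsub>V\<^esub> v))}"

definition H1 ::
    "('g, 'a) monoid_scheme \<Rightarrow> ('v, 'b) monoid_scheme \<Rightarrow> ('g \<Rightarrow> 'v \<Rightarrow> 'v) \<Rightarrow> ('g \<Rightarrow> 'v) set set"
  where "H1 \<Delta> V \<phi> = Z1 \<Delta> V \<phi> // cocycle_rel \<Delta> V \<phi>"

text \<open>The map on \<open>H\<^sup>1\<close> induced by restricting cocycles to the subgroup \<open>H\<close>. The union is over
  representatives of the class \<open>c\<close>, all of which give the same class; see \<open>res_H1_class\<close>.\<close>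

definition res_H1 :: "('g, 'a) monoid_scheme \<Rightarrow> 'g set \<Rightarrow> ('v, 'b) monoid_scheme \<Rightarrow>
    ('g \<Rightarrow> 'v \<Rightarrow> 'v) \<Rightarrow> ('g \<Rightarrow> 'v) set \<Rightarrow> ('g \<Rightarrow> 'v) set"
  where "res_H1 \<Delta> H V \<phi> c =
    (\<Union>\<theta>\<in>c. cocycle_rel (\<Delta>\<lparr>carrier := H\<rparr>) V \<phi> `` {restrict \<theta> H})"

lemma acts_by_automorphismsD:
  assumes "acts_by_automorphisms \<Delta> V \<phi>"
  shows "group \<Delta>"
    and "\<gamma> \<in> carrier \<Delta> \<Longrightarrow> \<phi> \<gamma> \<in> hom V V"
    and "\<gamma> \<in> carrier \<Delta> \<Longrightarrow> v \<in> carrier V \<Longrightarrow> \<phi> \<gamma> v \<in> carrier V"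
    and "\<gamma> \<in> carrier \<Delta> \<Longrightarrow> v \<in> carrier V \<Longrightarrow> w \<in> carrier V
      \<Longrightarrow> \<phi> \<gamma> (v \<otimes>\<^bsub>V\<^esub> w) = \<phi> \<gamma> v \<otimes>\<^bsub>V\<^esub> \<phi> \<gamma> w"
proof -
  interpret group_hom \<Delta> "AutoGroup V" \<phi> using assms by (simp add: acts_by_automorphisms_def)
  show "group \<Delta>" by (rule G.group_axioms)
  have *: "\<phi> \<gamma> \<in> hom V V" if "\<gamma> \<in> carrier \<Delta>" for \<gamma>
    using hom_closed[OF that] by (simp add: AutoGroup_def auto_def)
  then show "\<gamma> \<in> carrier \<Delta> \<Longrightarrow> \<phi> \<gamma> \<in> hom V V" .
  show "\<gamma> \<in> carrier \<Delta> \<Longrightarrow> v \<in> carrier V \<Longrightarrow> \<phi> \<gamma> v \<in> carrier V"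
    using * by (auto simp: hom_def)
  show "\<gamma> \<in> carrier \<Delta> \<Longrightarrow> v \<in> carrier V \<Longrightarrow> w \<in> carrier V
      \<Longrightarrow> \<phi> \<gamma> (v \<otimes>\<^bsub>V\<^esub> w) = \<phi> \<gamma> v \<otimes>\<^bsub>V\<^esub> \<phi> \<gamma> w"
    using * by (auto simp: hom_def)
qed

lemma equiv_cocycle_rel:
  assumes V: "group V" and act: "acts_by_automorphisms \<Delta> V \<phi>"
  shows "equiv (Z1 \<Delta> V \<phi>) (cocycle_rel \<Delta> V \<phi>)"
proof (rule equivI)
  interpret V: group V by fact
  note act' = acts_by_automorphismsD[OF act]
  have Z1_closed: "\<theta> \<gamma> \<in> carrier V" if "\<theta> \<in> Z1 \<Delta> V \<phi>" "\<gamma> \<in> carrier \<Delta>" for \<theta> \<gamma>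
    using that by (auto simp: Z1_def)
  have one: "\<phi> \<gamma> \<one>\<^bsub>V\<^esub> = \<one>\<^bsub>V\<^esub>" if "\<gamma> \<in> carrier \<Delta>" for \<gamma>
    using hom_one[OF act'(2)[OF that]] V by blast
  show "cocycle_rel \<Delta> V \<phi> \<subseteq> Z1 \<Delta> V \<phi> \<times> Z1 \<Delta> V \<phi>"
    by (auto simp: cocycle_rel_def)
  show "refl_on (Z1 \<Delta> V \<phi>) (cocycle_rel \<Delta> V \<phi>)"
    using Z1_closed
    by (auto intro!: refl_onI bexI[of _ "\<one>\<^bsub>V\<^esub>"] simp: cocycle_rel_def one)
  show "sym (cocycle_rel \<Delta> V \<phi>)"
  proof (rule symI)
    fix \<theta> \<theta>' assume "(\<theta>, \<theta>') \<in> cocycle_rel \<Delta> V \<phi>"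
    then obtain v where t: "\<theta> \<in> Z1 \<Delta> V \<phi>" "\<theta>' \<in> Z1 \<Delta> V \<phi>" and v: "v \<in> carrier V"
      and eq: "\<And>\<gamma>. \<gamma> \<in> carrier \<Delta> \<Longrightarrow> \<theta>' \<gamma> = v \<otimes>\<^bsub>V\<^esub> \<theta> \<gamma> \<otimes>\<^bsub>V\<^esub> \<phi> \<gamma> (inv\<^bsub>V\<^esub> v)"
      by (auto simp: cocycle_rel_def)
    have "\<theta> \<gamma> = inv\<^bsub>V\<^esub> v \<otimes>\<^bsub>V\<^esub> \<theta>' \<gamma> \<otimes>\<^bsub>V\<^esub> \<phi> \<gamma> (inv\<^bsub>V\<^esub> (inv\<^bsub>V\<^esub> v))" if g: "\<gamma> \<in> carrier \<Delta>" for \<gamma>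
    proof -
      have "\<phi> \<gamma> (inv\<^bsub>V\<^esub> v) \<otimes>\<^bsub>V\<^esub> \<phi> \<gamma> v = \<one>\<^bsub>V\<^esub>"
        using act'(4)[OF g, of "inv\<^bsub>V\<^esub> v" v] v one[OF g] by simp
      then have "\<theta>' \<gamma> \<otimes>\<^bsub>V\<^esub> \<phi> \<gamma> v = v \<otimes>\<^bsub>V\<^esub> \<theta> \<gamma>"
        using eq[OF g] v Z1_closed[OF t(1) g] act'(3)[OF g] by (simp add: V.m_assoc)
      then have "inv\<^bsub>V\<^esub> v \<otimes>\<^bsub>V\<^esub> (\<theta>' \<gamma> \<otimes>\<^bsub>V\<^esub> \<phi> \<gamma> v) = \<theta> \<gamma>"
        using v Z1_closed[OF t(1) g] by (simp add: V.m_assoc[symmetric])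
      then show ?thesis
        using v Z1_closed[OF t(2) g] act'(3)[OF g] by (simp add: V.m_assoc)
    qed
    then show "(\<theta>', \<theta>) \<in> cocycle_rel \<Delta> V \<phi>"
      using t v by (auto simp: cocycle_rel_def intro!: bexI[of _ "inv\<^bsub>V\<^esub> v"])
  qed
  show "trans (cocycle_rel \<Delta> V \<phi>)"
  proof (rule transI)
    fix \<theta> \<theta>' \<theta>'' assume "(\<theta>, \<theta>') \<in> cocycle_rel \<Delta> V \<phi>" "(\<theta>', \<theta>'') \<in> cocycle_rel \<Delta> V \<phi>"
    then obtain v w where t: "\<theta> \<in> Z1 \<Delta> V \<phi>" "\<theta>'' \<in> Z1 \<Delta> V \<phi>"
      and v: "v \<in> carrier V" and w: "w \<in> carrier V"
      and eq: "\<And>\<gamma>. \<gamma> \<in> carrier \<Delta> \<Longrightarrow> \<theta>' \<gamma> = v \<otimes>\<^bsub>V\<^esub> \<theta> \<gamma> \<otimes>\<^bsub>V\<^esub> \<phi> \<gamma> (inv\<^bsub>V\<^esub> v)"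
        "\<And>\<gamma>. \<gamma> \<in> carrier \<Delta> \<Longrightarrow> \<theta>'' \<gamma> = w \<otimes>\<^bsub>V\<^esub> \<theta>' \<gamma> \<otimes>\<^bsub>V\<^esub> \<phi> \<gamma> (inv\<^bsub>V\<^esub> w)"
      by (auto simp: cocycle_rel_def)
    have "\<theta>'' \<gamma> = (w \<otimes>\<^bsub>V\<^esub> v) \<otimes>\<^bsub>V\<^esub> \<theta> \<gamma> \<otimes>\<^bsub>V\<^esub> \<phi> \<gamma> (inv\<^bsub>V\<^esub> (w \<otimes>\<^bsub>V\<^esub> v))"
      if g: "\<gamma> \<in> carrier \<Delta>" for \<gamma>
      using eq[OF g] v w Z1_closed[OF t(1) g] act'(3)[OF g] act'(4)[OF g]
      by (simp add: V.m_assoc V.inv_mult_group)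
    then show "(\<theta>, \<theta>'') \<in> cocycle_rel \<Delta> V \<phi>"
      using t v w by (auto simp: cocycle_rel_def intro!: bexI[of _ "w \<otimes>\<^bsub>V\<^esub> v"])
  qed
qed

lemma acts_by_automorphisms_subgroup:
  assumes "acts_by_automorphisms \<Delta> V \<phi>" "subgroup H \<Delta>"
  shows "acts_by_automorphisms (\<Delta>\<lparr>carrier := H\<rparr>) V \<phi>"
proof -
  interpret group_hom \<Delta> "AutoGroup V" \<phi> using assms by (simp add: acts_by_automorphisms_def)
  interpret H: subgroup H \<Delta> by fact
  show ?thesis
    unfolding acts_by_automorphisms_def group_hom_def group_hom_axioms_def
    using H.subgroup_is_group[OF G.group_axioms] H.group_axioms homh
    by (auto simp: hom_def)
qed

lemma res_H1_class:
  assumes V: "group V" and act: "acts_by_automorphisms \<Delta> V \<phi>" and H: "subgroup H \<Delta>"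
    and t: "\<theta> \<in> Z1 \<Delta> V \<phi>"
  shows "restrict \<theta> H \<in> Z1 (\<Delta>\<lparr>carrier := H\<rparr>) V \<phi>"
    and "res_H1 \<Delta> H V \<phi> (cocycle_rel \<Delta> V \<phi> `` {\<theta>})
      = cocycle_rel (\<Delta>\<lparr>carrier := H\<rparr>) V \<phi> `` {restrict \<theta> H}"
proof -
  interpret H: subgroup H \<Delta> by fact
  let ?R = "cocycle_rel (\<Delta>\<lparr>carrier := H\<rparr>) V \<phi>"
  have Z: "restrict \<eta> H \<in> Z1 (\<Delta>\<lparr>carrier := H\<rparr>) V \<phi>" if "\<eta> \<in> Z1 \<Delta> V \<phi>" for \<eta>
    using that by (auto simp: Z1_def)
  then show "restrict \<theta> H \<in> Z1 (\<Delta>\<lparr>carrier := H\<rparr>) V \<phi>" using t .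
  have rel: "(restrict \<theta> H, restrict \<eta> H) \<in> ?R" if "(\<theta>, \<eta>) \<in> cocycle_rel \<Delta> V \<phi>" for \<eta>
    using that Z unfolding cocycle_rel_def by auto
  have eq: "equiv (Z1 (\<Delta>\<lparr>carrier := H\<rparr>) V \<phi>) ?R"
    by (rule equiv_cocycle_rel[OF V acts_by_automorphisms_subgroup[OF act H]])
  have "?R `` {restrict \<eta> H} = ?R `` {restrict \<theta> H}" if "(\<theta>, \<eta>) \<in> cocycle_rel \<Delta> V \<phi>" for \<eta>
    using equiv_class_eq[OF eq rel[OF that]] by simp
  moreover have "\<theta> \<in> cocycle_rel \<Delta> V \<phi> `` {\<theta>}"
    by (rule equiv_class_self[OF equiv_cocycle_rel[OF V act] t])
  ultimately show "res_H1 \<Delta> H V \<phi> (cocycle_rel \<Delta> V \<phi> `` {\<theta>}) = ?R `` {restrict \<theta> H}"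
    unfolding res_H1_def by blast
qed


section \<open>Finite groups\<close>

text \<open>The dihedral group of order \<open>2q\<close>: the pair \<open>(a, e)\<close> stands for \<open>r\<^sup>a s\<^sup>e\<close>, where
  \<open>r\<^sup>q = s\<^sup>2 = 1\<close> and \<open>s r s = r\<^sup>-\<^sup>1\<close>.\<close>

definition dihedral_group :: "nat \<Rightarrow> (int \<times> bool) monoid"
  where "dihedral_group q =
    \<lparr>carrier = {0..<int q} \<times> UNIV,
     monoid.mult = (\<lambda>(a, e) (b, f). ((if e then a - b else a + b) mod int q, e \<noteq> f)),
     one = (0, False)\<rparr>"

lemma group_dihedral_group:
  assumes "q > 0"
  shows "group (dihedral_group q)"
proof (rule groupI)
  fix x y z
  assume "x \<in> carrier (dihedral_group q)" "y \<in> carrier (dihedral_group q)"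
    "z \<in> carrier (dihedral_group q)"
  obtain a e b f c g where xyz: "x = (a, e)" "y = (b, f)" "z = (c, g)"
    by (metis surj_pair)
  show "x \<otimes>\<^bsub>dihedral_group q\<^esub> y \<otimes>\<^bsub>dihedral_group q\<^esub> z
      = x \<otimes>\<^bsub>dihedral_group q\<^esub> (y \<otimes>\<^bsub>dihedral_group q\<^esub> z)"
    unfolding xyz
    by (cases e; cases f) (simp_all add: dihedral_group_def mod_simps add.assoc diff_diff_eq diff_diff_eq2
        add_diff_eq diff_add_eq)
next
  fix x assume x: "x \<in> carrier (dihedral_group q)"
  obtain a e where ae: "x = (a, e)" by (cases x)
  show "\<exists>y\<in>carrier (dihedral_group q). y \<otimes>\<^bsub>dihedral_group q\<^esub> x = \<one>\<^bsub>dihedral_group q\<^esub>"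
  proof (cases e)
    case True
    with x ae show ?thesis
      by (intro bexI[of _ x]) (simp_all add: dihedral_group_def)
  next
    case False
    with ae assms show ?thesis
      by (intro bexI[of _ "((- a) mod int q, False)"]) (simp_all add: dihedral_group_def mod_simps)
  qed
qed (use assms in \<open>auto simp: dihedral_group_def\<close>)

lemma order_dihedral_group: "Coset.order (dihedral_group q) = 2 * q"
  by (simp add: Coset.order_def dihedral_group_def card_cartesian_product)

definition sylow_subgroup :: "nat \<Rightarrow> ('g, 'a) monoid_scheme \<Rightarrow> 'g set \<Rightarrow> bool"
  where "sylow_subgroup p G P \<longleftrightarrow>
    subgroup P G \<and> card P = p ^ multiplicity p (Coset.order G)"

end

theory Submission
  imports Defs "HOL-Algebra.Multiplicative_Group"
begin

text \<open>Take for \<open>V\<close> the unitriangular \<open>3 \<times> 3\<close> matrices, written \<open>(x, y, c)\<close>, and let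
  \<open>r\<close> act by \<open>(x, y, c) \<mapsto> (z x, z\<^sup>-\<^sup>1 y, c)\<close> with \<open>z\<^sup>q = 1 \<noteq> z\<close>, the reflection \<open>s\<close> by
  \<open>(x, y, c) \<mapsto> (y, x, c + x y)\<close>, and \<open>C\<^sub>2\<close> trivially. For each \<open>c\<close> the homomorphism \<open>\<Gamma> \<rightarrow> V\<close> that
  kills rotations and \<open>C\<^sub>2\<close> and sends reflections to the central element \<open>(0, 0, c)\<close> is a cocycle,
  as the centre is fixed by \<open>\<Gamma>\<close>. An element conjugating one such cocycle into another is fixed by
  \<open>r\<close>, hence central, and changes nothing, so these cocycles lie in different classes. A Sylow
  2-subgroup, however, meets the rotations trivially and contains a single reflection \<open>r\<^sup>a s\<close> up to
  \<open>C\<^sub>2\<close>; with \<open>v = (z\<^sup>a y, y, 0)\<close> one finds \<open>v (r\<^sup>a s \<cdot> v\<^sup>-\<^sup>1) = (0, 0, z\<^sup>a y\<^sup>2)\<close>, and since \<open>y\<^sup>2\<close> takes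
  all values, all restrictions are trivial in cohomology.\<close>

section \<open>Unitriangular matrices in coordinates\<close>

text \<open>The corner entry comes last: \<open>x\<close> and \<open>y\<close> are coordinates
  modulo the centre, and \<open>c\<close> is the coordinate on the centre.\<close>

definition unitri :: "'k::field \<Rightarrow> 'k \<Rightarrow> 'k \<Rightarrow> 'k mat"
  where "unitri x y c = mat_of_rows_list 3 [[1, x, c], [0, 1, y], [0, 0, 1]]"

definition Heis :: "'k::field mat set"
  where "Heis = {unitri x y c |x y c. True}"

abbreviation HeisG :: "'k::field mat monoid"
  where "HeisG \<equiv> GL 3\<lparr>carrier := Heis\<rparr>"

lemma less_3_cases: "i < 3 \<longleftrightarrow> i = 0 \<or> i = 1 \<or> i = (2::nat)"
  by auto

lemma dim_unitri [simp]: "dim_row (unitri x y c) = 3" "dim_col (unitri x y c) = 3"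
  by (simp_all add: unitri_def mat_of_rows_list_def)

lemma sum_atLeast0_lessThan_3: "(\<Sum>i = 0..<3. f i) = f 0 + f (Suc 0) + f 2"
  by (simp add: numeral_3_eq_3 numeral_2_eq_2)

lemma unitri_carrier [simp]: "unitri x y c \<in> carrier_mat 3 3"
  by (rule carrier_matI) simp_all

lemma unitri_index [simp]:
  "unitri x y c $$ (0, 0) = 1" "unitri x y c $$ (0, Suc 0) = x" "unitri x y c $$ (0, 2) = c"
  "unitri x y c $$ (Suc 0, 0) = 0" "unitri x y c $$ (Suc 0, Suc 0) = 1" "unitri x y c $$ (Suc 0, 2) = y"
  "unitri x y c $$ (2, 0) = 0" "unitri x y c $$ (2, Suc 0) = 0" "unitri x y c $$ (2, 2) = 1"
  by (simp_all add: unitri_def mat_of_rows_list_def)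

lemma unitri_lower:
  assumes "j \<le> i" and "i < 3"
  shows "unitri x y c $$ (i, j) = (if i = j then 1 else 0)"
  using assms le_less_trans[OF assms] by (auto simp: less_3_cases)

lemma unitri_inject [simp]: "unitri x y c = unitri x' y' c' \<longleftrightarrow> x = x' \<and> y = y' \<and> c = c'"
  by (metis unitri_index(2,3,6))

lemma unitri_mult: "unitri x y c * unitri x' y' c' = unitri (x + x') (y + y') (c + c' + x * y')"
  by (rule eq_matI) (auto simp: less_3_cases scalar_prod_def sum_atLeast0_lessThan_3 algebra_simps)

lemma unitri_one: "1\<^sub>m 3 = unitri 0 0 0"
  by (rule eq_matI) (auto simp: less_3_cases)

lemma det_unitri: "det (unitri x y c) = 1"
proof -
  have "upper_triangular (unitri x y c)"
    by (auto simp: upper_triangular_def unitri_lower)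
  then have "det (unitri x y c) = prod_list (diag_mat (unitri x y c))"
    by (rule det_upper_triangular[OF _ unitri_carrier])
  then show ?thesis
    by (simp add: diag_mat_def numeral_3_eq_3 unitri_lower)
qed

lemma unitri_in_Heis [simp]: "unitri x y c \<in> Heis"
  by (auto simp: Heis_def)

lemma HeisE:
  assumes "A \<in> Heis"
  obtains x y c where "A = unitri x y c"
  using assms by (auto simp: Heis_def)

section \<open>The unitriangular matrices as a closed unipotent subgroup\<close>

lemma group_GL: "group (GL n :: 'k::field mat monoid)"
proof -
  interpret ring "ring_mat TYPE('k) n ()" by (rule ring_mat)
  show ?thesis by (rule units_group)
qed

lemma GL_simps:
  "monoid.mult (GL n) = ((*) :: 'k::field mat \<Rightarrow> _)" "one (GL n) = (1\<^sub>m n :: 'k::field mat)"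
  by (simp_all add: units_of_mult units_of_one ring_mat_simps)

lemma Heis_subset_GL: "Heis \<subseteq> carrier (GL 3)"
proof
  fix A :: "'a mat" assume "A \<in> Heis"
  then obtain x y c where A: "A = unitri x y c" by (rule HeisE)
  \<comment> \<open>The corner entry solves \<open>c + c' + x * (- y) = 0\<close> for
    \<open>c'\<close>.\<close>
  have "unitri (- x) (- y) (x * y - c) * A = 1\<^sub>m 3" "A * unitri (- x) (- y) (x * y - c) = 1\<^sub>m 3"
    by (simp_all add: A unitri_mult unitri_one)
  then show "A \<in> carrier (GL 3)"
    unfolding units_of_carrier Units_def ring_mat_simps A
    by (auto intro!: bexI[of _ "unitri (- x) (- y) (x * y - c)"])
qed

lemma inv_GL_unitri: "inv\<^bsub>GL 3\<^esub> (unitri x y c) = unitri (- x) (- y) (x * y - c)"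
  using Heis_subset_GL
  by (intro group.inv_equality[OF group_GL])
    (auto simp: GL_simps unitri_mult unitri_one)

lemma Heis_nonempty: "Heis \<noteq> {}"
  using unitri_in_Heis by blast

lemma subgroup_Heis: "subgroup Heis (GL 3)"
  by (rule group.subgroupI[OF group_GL Heis_subset_GL Heis_nonempty])
    (auto elim!: HeisE simp: inv_GL_unitri GL_simps unitri_mult)

lemma inv_HeisG: "inv\<^bsub>HeisG\<^esub> (unitri x y c) = unitri (- x) (- y) (x * y - c)"
  by (simp add: group.m_inv_consistent[OF group_GL subgroup_Heis] inv_GL_unitri)

lemma HeisG_simps [simp]: "monoid.mult HeisG = ((*) :: 'k::field mat \<Rightarrow> _)" "one HeisG = unitri 0 0 0"
  by (simp_all add: GL_simps unitri_one)

lemma carrier_HeisG: "carrier HeisG = Heis"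
  by simp

lemma group_HeisG: "group HeisG"
  by (rule group.subgroup_imp_group[OF group_GL subgroup_Heis])

lemma closedin_Heis: "closedin (zariski 3) (Heis :: 'k::field mat set)"
proof -
  \<comment> \<open>On and below the diagonal the entries must agree with the identity. The
    equations are sums because \<open>regular_functions\<close> has rules for sums and constants,
    not for differences.\<close>
  let ?F = "(\<lambda>(i, j) (A :: 'k mat). A $$ (i, j) + (if i = j then - 1 else 0)) ` {(i, j). j \<le> i \<and> i < (3::nat)}"
  have "?F \<subseteq> regular_functions 3"
    by (auto intro!: regular_functions.intros)
  moreover have "Heis = zero_locus 3 ?F"
  proof (intro equalityI subsetI)
    fix A :: "'k mat" assume "A \<in> Heis"
    then show "A \<in> zero_locus 3 ?F"
      using Heis_subset_GL by (auto simp: zero_locus_def unitri_lower elim!: HeisE)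
  next
    fix A :: "'k mat" assume A: "A \<in> zero_locus 3 ?F"
    then have carrier: "A \<in> carrier_mat 3 3"
      by (auto simp: zero_locus_def units_of_carrier Units_def ring_mat_simps)
    have "\<And>i j. j \<le> i \<Longrightarrow> i < 3 \<Longrightarrow> A $$ (i, j) + (if i = j then - 1 else 0) = 0"
      using A by (auto simp: zero_locus_def)
    from this[of 0 0] this[of 0 1] this[of 1 1] this[of 0 2] this[of 1 2] this[of 2 2]
    have "A = unitri (A $$ (0, 1)) (A $$ (1, 2)) (A $$ (0, 2))"
      using carrier by (intro eq_matI) (auto simp: less_3_cases)
    then show "A \<in> Heis" by (metis unitri_in_Heis)
  qed
  ultimately show ?thesis unfolding closedin_zariski by blast
qed

lemma unipotent_unitri: "unipotent_mat 3 (unitri x y c)"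
proof -
  \<comment> \<open>A strictly upper triangular 3 by 3 matrix has cube zero.\<close>
  have "(unitri x y c - 1\<^sub>m 3) ^\<^sub>m Suc (Suc (Suc 0)) = 0\<^sub>m 3 3"
    by (rule eq_matI) (auto simp: less_3_cases scalar_prod_def sum_atLeast0_lessThan_3)
  then show ?thesis unfolding unipotent_mat_def by blast
qed

lemma unipotent_group_Heis: "unipotent_group 3 Heis"
  by (auto simp: unipotent_group_def linear_algebraic_group_def subgroup_Heis closedin_Heis
      unipotent_unitri elim!: HeisE)

section \<open>Connectedness\<close>

text \<open>The determinant is constant on \<open>Heis\<close>, so the regular functions restrict to polynomials.\<close>

lemma regular_function_on_line:
  assumes "f \<in> regular_functions 3"
  shows "\<exists>p. \<forall>t. f (unitri (x + t * x') (y + t * y') (c + t * c')) = poly p t"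
  using assms
proof induction
  case (const a)
  then show ?case by (intro exI[of _ "[:a:]"]) simp
next
  case (entry i j)
  \<comment> \<open>The slope is the entry of the direction; subtracting the identity makes it 0 on
    the diagonal, where the entries stay 1.\<close>
  let ?p = "[:unitri x y c $$ (i, j), (unitri x' y' c' - 1\<^sub>m 3) $$ (i, j):]"
  have "unitri (x + t * x') (y + t * y') (c + t * c') $$ (i, j) = poly ?p t" for t
    using entry by (auto simp: less_3_cases)
  then show ?case by blast
next
  case inverse_det
  then show ?case by (intro exI[of _ "[:1:]"]) (simp add: det_unitri)
next
  case (add f g)
  then show ?case by (metis poly_add)
next
  case (mult f g)
  then show ?case by (metis poly_mult)
qed

text \<open>Any two points lie on an affine line inside \<open>Heis\<close>. A closed set missing a
  point of that line meets it in the zeros of a nonzero polynomial, hence finitely often, and two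
  such sets cannot cover a line over an infinite field.\<close>

lemma connectedin_Heis:
  assumes "infinite (UNIV :: 'k::field set)"
  shows "connectedin (zariski 3) (Heis :: 'k mat set)"
proof -
  have False if E: "closedin (zariski 3) E" "closedin (zariski 3) E'" "Heis \<subseteq> E \<union> E'"
    "E \<inter> E' \<inter> Heis = {}" "A \<in> E \<inter> Heis" "A' \<in> E' \<inter> Heis" for E E' and A A' :: "'k mat"
  proof -
    obtain x y c x' y' c' where AA': "A = unitri x y c" "A' = unitri x' y' c'"
      using E(5,6) by (meson IntD2 HeisE)
    define l where "l t = unitri (x + t * (x' - x)) (y + t * (y' - y)) (c + t * (c' - c))" for t
    have fin: "finite {t. l t \<in> D}" if D: "closedin (zariski 3) D" "l t0 \<notin> D" for D t0
    proof -
      obtain F where F: "F \<subseteq> regular_functions 3" "D = zero_locus 3 F"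
        using D(1) unfolding closedin_zariski by blast
      with D(2) obtain f where f: "f \<in> F" "f (l t0) \<noteq> 0"
        using Heis_subset_GL unitri_in_Heis unfolding zero_locus_def l_def by blast
      obtain p where p: "\<And>t. f (l t) = poly p t"
        using regular_function_on_line[of f] f F unfolding l_def by blast
      have "{t. l t \<in> D} \<subseteq> {t. poly p t = 0}"
        using f(1) by (auto simp: F(2) zero_locus_def simp flip: p)
      moreover have "p \<noteq> 0" using f(2) p by auto
      ultimately show ?thesis using poly_roots_finite finite_subset by blast
    qed
    have "l 0 = A" "l 1 = A'" by (simp_all add: l_def AA')
    \<comment> \<open>Disjointness on \<open>Heis\<close> makes each of the two closed sets miss one
      endpoint.\<close>
    with E(4-6) have "l 1 \<notin> E" "l 0 \<notin> E'" by auto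
    with fin[OF E(1)] fin[OF E(2)] have "finite ({t. l t \<in> E} \<union> {t. l t \<in> E'})" by simp
    moreover have "{t. l t \<in> E} \<union> {t. l t \<in> E'} = UNIV"
      using E(3) unitri_in_Heis unfolding l_def by blast
    ultimately show False using assms by simp
  qed
  then show ?thesis
    unfolding connectedin_closedin topspace_zariski ex_in_conv[symmetric] using Heis_subset_GL
    by metis
qed

section \<open>Algebraically closed fields: infinitude and roots of unity\<close>

text \<open>Over a finite field, 1 plus the product of all \<open>X - a\<close> would be a
  nonconstant polynomial without roots.\<close>

lemma infinite_alg_closed_field: "infinite (UNIV :: 'k::alg_closed_field set)"
proof
  assume fin: "finite (UNIV :: 'k set)"
  define p :: "'k poly" where "p = (\<Prod>a\<in>UNIV. [:- a, 1:]) + 1"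
  have "poly p x = 1" for x
    using fin by (auto simp: p_def poly_prod)
  moreover have "degree (\<Prod>a\<in>UNIV. [:- a, 1:] :: 'k poly) = card (UNIV :: 'k set)"
    by (subst degree_prod_eq_sum_degree) auto
  then have "degree p > 0"
    using fin unfolding p_def by (subst degree_add_eq_left) (auto simp: card_gt_0_iff)
  then obtain x where "poly p x = 0"
    using alg_closed_imp_poly_has_root by blast
  ultimately show False by simp
qed

text \<open>Any root of \<open>1 + X + ... + X^(q-1)\<close> works: it satisfies
  \<open>z ^ q = 1\<close>, and it is not 1, since the value at 1 is \<open>q\<close>, which is odd
  and so nonzero in characteristic 2.\<close>

lemma exists_nontrivial_root_of_unity:
  assumes "CHAR('k::alg_closed_field) = 2" and "odd q" and "q > 1"
  obtains z :: "'k::alg_closed_field" where "z ^ q = 1" and "z \<noteq> 1"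
proof -
  define p :: "'k poly" where "p = (\<Sum>i<q. Polynomial.monom 1 i)"
  have "Polynomial.coeff p (q - 1) = 1"
    using assms by (simp add: p_def coeff_sum)
  then have "degree p \<ge> q - 1" by (intro le_degree) simp
  then have "degree p > 0" using assms by simp
  then obtain z where z: "poly p z = 0"
    using alg_closed_imp_poly_has_root by blast
  then have sum: "(\<Sum>i<q. z ^ i) = 0"
    by (simp add: p_def poly_sum poly_monom)
  then have "z ^ q = 1" using power_diff_1_eq[of z q] by simp
  moreover have "(of_nat q :: 'k) \<noteq> 0"
    using assms by (simp add: of_nat_eq_0_iff_char_dvd)
  with sum have "z \<noteq> 1" by auto
  ultimately show ?thesis by (rule that)
qed


section \<open>The action in coordinates and its regularity\<close>

lemma carrier_dihedral_group: "carrier (dihedral_group q) = {0..<int q} \<times> UNIV"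
  by (simp add: dihedral_group_def)

lemma mult_dihedral_group:
  "(a, e) \<otimes>\<^bsub>dihedral_group q\<^esub> (b, f) = ((if e then a - b else a + b) mod int q, e \<noteq> f)"
  by (simp add: dihedral_group_def)

lemma one_dihedral_group: "\<one>\<^bsub>dihedral_group q\<^esub> = (0, False)"
  by (simp add: dihedral_group_def)

text \<open>The term \<open>x y\<close> makes the action of the reflections multiplicative, in characteristic 2 only.\<close>

definition heis_act :: "'k::field \<Rightarrow> (int \<times> bool) \<times> int \<Rightarrow> 'k mat \<Rightarrow> 'k mat"
  where "heis_act z = (\<lambda>((a, e), _). \<lambda>A\<in>Heis.
    if e then unitri (z powi a * A $$ (1, 2)) (z powi (- a) * A $$ (0, 1))
      (A $$ (0, 2) + A $$ (0, 1) * A $$ (1, 2))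
    else unitri (z powi a * A $$ (0, 1)) (z powi (- a) * A $$ (1, 2)) (A $$ (0, 2)))"

lemma heis_act_unitri:
  "heis_act z ((a, e), f) (unitri x y c) =
    (if e then unitri (z powi a * y) (z powi (- a) * x) (c + x * y)
     else unitri (z powi a * x) (z powi (- a) * y) c)"
  by (simp add: heis_act_def)

lemma heis_act_closed: "A \<in> Heis \<Longrightarrow> heis_act z \<gamma> A \<in> Heis"
  by (cases \<gamma> rule: prod.exhaust[case_product prod.exhaust])
    (auto simp: heis_act_unitri elim!: HeisE)

text \<open>The remaining entries of the image are the constants 0 and 1, which are regular.\<close>

lemma regular_map_unitri:
  assumes "f \<in> regular_functions 3" "g \<in> regular_functions 3" "h \<in> regular_functions 3"
    and "\<And>A. A \<in> Heis \<Longrightarrow> F A = unitri (f A) (g A) (h A)"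
  shows "regular_map 3 Heis F"
  unfolding regular_map_def
  using assms(1-3) regular_functions.const[of 0 3] regular_functions.const[of 1 3]
  by (auto simp: assms(4) less_3_cases intro: bexI[of _ f] bexI[of _ g] bexI[of _ h]
      bexI[of _ "\<lambda>_. 0"] bexI[of _ "\<lambda>_. 1"])

lemma regular_map_heis_act: "regular_map 3 Heis (heis_act z ((a, e), f))"
  by (cases e; rule regular_map_unitri)
    (auto simp: heis_act_def simp del: One_nat_def intro!: regular_functions.intros)

section \<open>Characteristic 2: the group laws of the action\<close>

context
  fixes q :: nat and z :: "'k::alg_closed_field"
  assumes char_2: "CHAR('k) = 2" and q: "odd q" "q > 1" and z: "z ^ q = 1" "z \<noteq> 1"
begin

private abbreviation (input) "\<Gamma> \<equiv> dihedral_group q \<times>\<times> integer_mod_group 2"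

lemma add_self: "x + x = (0 :: 'k)"
proof -
  have "(2 :: 'k) = 0" using of_nat_CHAR[where 'a = 'k] by (simp add: char_2)
  then show ?thesis by (metis mult_2 mult_zero_left)
qed

lemma uminus_self: "- x = (x :: 'k)"
  using add_self[of x] by (simp add: add_eq_0_iff)

text \<open>Cancels repeated summands inside longer right-nested sums, where \<open>add_self\<close>
  does not match.\<close>

lemma add_self_left: "x + (x + y) = (y :: 'k)"
  by (simp add: add_self flip: add.assoc)

lemma z_nonzero: "z \<noteq> 0"
  using z q by (metis power_0_left zero_neq_one odd_pos less_numeral_extra(3))

text \<open>Multiplication in the dihedral group reduces exponents modulo \<open>q\<close>, which
  \<open>z ^ q = 1\<close> makes harmless.\<close>

lemma z_powi_mod: "z powi (m mod int q) = z powi m"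
proof -
  have "z powi m = z powi (int q * (m div int q) + m mod int q)" by simp
  also have "\<dots> = z powi (m mod int q)"
    unfolding power_int_add[OF disjI1[OF z_nonzero]] power_int_mult by (simp add: z)
  finally show ?thesis ..
qed

lemma z_powi_minus_mod: "z powi (- (m mod int q)) = z powi (- m)"
  by (simp add: power_int_minus z_powi_mod)

lemma group_\<Gamma>: "group \<Gamma>"
  using q by (intro DirProd_group group_dihedral_group group_integer_mod_group) auto

lemma heis_act_one: "A \<in> Heis \<Longrightarrow> heis_act z ((0, False), 0) A = A"
  by (auto simp: heis_act_unitri elim!: HeisE)

text \<open>Rotations and reflections both preserve the product \<open>x * y\<close>, so the corner
  corrections of two successive reflections are equal and cancel.\<close>

lemma heis_act_mult:
  assumes "A \<in> Heis"
  shows "heis_act z (\<gamma> \<otimes>\<^bsub>\<Gamma>\<^esub> \<delta>) A = heis_act z \<gamma> (heis_act z \<delta> A)"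
proof -
  obtain a e f where \<gamma>: "\<gamma> = ((a, e), f)" by (metis surj_pair)
  obtain b g h where \<delta>: "\<delta> = ((b, g), h)" by (metis surj_pair)
  obtain x y c where A: "A = unitri x y c" using assms by (rule HeisE)
  show ?thesis
    using z_nonzero unfolding \<gamma> \<delta> A
    by (simp add: mult_dihedral_group heis_act_unitri z_powi_mod z_powi_minus_mod power_int_add power_int_diff
        power_int_minus add_self field_simps)
qed

text \<open>For a rotation the powers of \<open>z\<close> cancel in \<open>x * y'\<close>. For a
  reflection the correction \<open>(x + x') * (y + y')\<close> replaces \<open>x * y'\<close> by the
  required \<open>y * x'\<close>, as \<open>x * y'\<close> then occurs twice.\<close>

lemma heis_act_hom:
  assumes "A \<in> Heis" "B \<in> Heis"
  shows "heis_act z \<gamma> (A * B) = heis_act z \<gamma> A * heis_act z \<gamma> B"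
proof -
  obtain a e f where \<gamma>: "\<gamma> = ((a, e), f)" by (metis surj_pair)
  obtain x y c where A: "A = unitri x y c" using assms(1) by (rule HeisE)
  obtain x' y' c' where B: "B = unitri x' y' c'" using assms(2) by (rule HeisE)
  show ?thesis
    using z_nonzero unfolding \<gamma> A B
    by (simp add: heis_act_unitri unitri_mult power_int_minus algebra_simps add_self add_self_left)
qed

lemma heis_act_auto:
  assumes "\<gamma> \<in> carrier \<Gamma>"
  shows "heis_act z \<gamma> \<in> auto HeisG"
proof -
  interpret group \<Gamma> by (rule group_\<Gamma>)
  have "heis_act z \<gamma> \<in> extensional Heis"
    by (auto simp: heis_act_def split: prod.split)
  moreover have "bij_betw (heis_act z \<gamma>) Heis Heis"
    \<comment> \<open>The inverse group element acts as the inverse map.\<close>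
    using assms by (intro bij_betw_byWitness[where f' = "heis_act z (inv\<^bsub>\<Gamma>\<^esub> \<gamma>)"])
      (auto simp: heis_act_closed heis_act_one one_dihedral_group simp flip: heis_act_mult)
  ultimately show ?thesis
    by (auto simp: auto_def Bij_def hom_def heis_act_closed heis_act_hom)
qed

lemma acts_by_automorphisms_heis_act: "acts_by_automorphisms \<Gamma> HeisG (heis_act z)"
  unfolding acts_by_automorphisms_def group_hom_def group_hom_axioms_def
proof (intro conjI group_\<Gamma> group.AutoGroup[OF group_HeisG] homI)
  fix \<gamma> assume \<gamma>: "\<gamma> \<in> carrier \<Gamma>"
  then show "heis_act z \<gamma> \<in> carrier (AutoGroup HeisG)"
    by (simp add: AutoGroup_def heis_act_auto)
  fix \<delta> assume \<delta>: "\<delta> \<in> carrier \<Gamma>"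
  have "heis_act z (\<gamma> \<otimes>\<^bsub>\<Gamma>\<^esub> \<delta>) = compose Heis (heis_act z \<gamma>) (heis_act z \<delta>)"
  proof
    fix A show "heis_act z (\<gamma> \<otimes>\<^bsub>\<Gamma>\<^esub> \<delta>) A = compose Heis (heis_act z \<gamma>) (heis_act z \<delta>) A"
      \<comment> \<open>Outside \<open>Heis\<close> both sides are \<open>undefined\<close>.\<close>
      by (cases "A \<in> Heis") (simp_all add: heis_act_mult compose_def, simp add: heis_act_def split: prod.split)
  qed
  then show "heis_act z (\<gamma> \<otimes>\<^bsub>\<Gamma>\<^esub> \<delta>) = heis_act z \<gamma> \<otimes>\<^bsub>AutoGroup HeisG\<^esub> heis_act z \<delta>"
    using heis_act_auto[OF \<gamma>] heis_act_auto[OF \<delta>]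
    by (simp add: AutoGroup_def BijGroup_def auto_def)
qed

section \<open>Cocycles with central values\<close>

private definition central_cocycle :: "'k \<Rightarrow> (int \<times> bool) \<times> int \<Rightarrow> 'k mat"
  where "central_cocycle c = (\<lambda>\<gamma>\<in>carrier \<Gamma>. unitri 0 0 (if snd (fst \<gamma>) then c else 0))"

text \<open>The action fixes each \<open>unitri 0 0 c\<close>, so the cocycle condition is
  multiplicativity; two reflections multiply to a rotation, matching
  \<open>c + c = 0\<close>.\<close>

lemma central_cocycle_in_Z1: "central_cocycle c \<in> Z1 \<Gamma> HeisG (heis_act z)"
proof -
  have "central_cocycle c (\<gamma> \<otimes>\<^bsub>\<Gamma>\<^esub> \<delta>) = central_cocycle c \<gamma> * heis_act z \<gamma> (central_cocycle c \<delta>)"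
    if "\<gamma> \<in> carrier \<Gamma>" "\<delta> \<in> carrier \<Gamma>" for \<gamma> \<delta>
  proof -
    obtain a e f where \<gamma>: "\<gamma> = ((a, e), f)" by (metis surj_pair)
    obtain b g h where \<delta>: "\<delta> = ((b, g), h)" by (metis surj_pair)
    have "\<gamma> \<otimes>\<^bsub>\<Gamma>\<^esub> \<delta> \<in> carrier \<Gamma>"
      using that by (rule monoid.m_closed[OF group.is_monoid[OF group_\<Gamma>]])
    then show ?thesis
      using that unfolding central_cocycle_def \<gamma> \<delta>
      by (simp add: mult_dihedral_group heis_act_unitri unitri_mult add_self)
  qed
  moreover have "central_cocycle c \<in> carrier \<Gamma> \<rightarrow>\<^sub>E Heis"
    unfolding central_cocycle_def by simp
  ultimately show ?thesis
    unfolding Z1_def HeisG_simps carrier_HeisG by (intro CollectI conjI ballI)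
qed

lemma central_cocycle_rel_imp_eq:
  assumes "(central_cocycle c, central_cocycle c') \<in> cocycle_rel \<Gamma> HeisG (heis_act z)"
  shows "c = c'"
proof -
  obtain v where "v \<in> Heis" and v: "\<And>\<gamma>. \<gamma> \<in> carrier \<Gamma> \<Longrightarrow>
      central_cocycle c' \<gamma> = v * central_cocycle c \<gamma> * heis_act z \<gamma> (inv\<^bsub>HeisG\<^esub> v)"
    using assms unfolding cocycle_rel_def HeisG_simps by auto
  then obtain x y w where xyw: "v = unitri x y w" by (auto elim: HeisE)
  have "((1, False), 0) \<in> carrier \<Gamma>" "((0, True), 0) \<in> carrier \<Gamma>"
    using q by (auto simp: carrier_dihedral_group carrier_integer_mod_group)
  note v[OF this(1)] v[OF this(2)] this
  \<comment> \<open>The first two equations come from the rotation, where both cocycles are trivial;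
    the third is the corner entry at the reflection. As \<open>z \<noteq> 1\<close>, the first gives
    \<open>x = 0\<close>.\<close>
  then have "x = z * x" "z * y = y" "c' = x * x + c"
    using z_nonzero
    by (auto simp: central_cocycle_def heis_act_unitri unitri_mult xyw inv_HeisG uminus_self
        add_self add_self_left power_int_minus field_simps add_eq_0_iff)
  with z show ?thesis by simp
qed

section \<open>Restriction to 2-subgroups\<close>

text \<open>The rotation group has odd order \<open>q\<close>, so a 2-subgroup has trivial rotation
  part; two of its reflections differ by a rotation and so share the same exponent.\<close>

lemma two_subgroup_reflections:
  assumes H: "subgroup H \<Gamma>" and card: "card H = 2 ^ m"
  obtains a where "\<And>b e f. ((b, e), f) \<in> H \<Longrightarrow> b = (if e then a else 0)"
proof -
  have rotation: "b = 0" if "((b, False), f) \<in> H" for b f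
  proof -
    have pow: "fst (((b, False), f) [^]\<^bsub>\<Gamma>\<^esub> n) = (int n * b mod int q, False)" for n :: nat
    proof (induction n)
      case (Suc n)
      then show ?case
        by (cases "((b, False), f) [^]\<^bsub>\<Gamma>\<^esub> n") (simp add: mult_dihedral_group mod_simps algebra_simps)
    qed (simp add: one_dihedral_group)
    \<comment> \<open>Powers in \<open>H\<close> and in the whole group agree, as only the carrier
      differs.\<close>
    have "((b, False), f) [^]\<^bsub>\<Gamma>\<^esub> card H = \<one>\<^bsub>\<Gamma>\<^esub>"
      using group.pow_order_eq_1[OF group.subgroup_imp_group[OF group_\<Gamma> H]] that
      by (simp add: Coset.order_def nat_pow_def)
    with pow[of "card H"] have "int q dvd 2 ^ m * b"
      by (simp add: one_dihedral_group card mod_eq_0_iff_dvd)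
    moreover have "coprime (int q) (2 ^ m)"
      using q by (simp add: coprime_commute)
    ultimately have "int q dvd b" by (simp add: coprime_dvd_mult_right_iff)
    moreover have "0 \<le> b" "b < int q"
      using subgroup.mem_carrier[OF H that] by (auto simp: carrier_dihedral_group carrier_integer_mod_group)
    ultimately show "b = 0" by (metis zdvd_not_zless order_le_less)
  qed
  have reflection: "b = b'" if "((b, True), f) \<in> H" "((b', True), f') \<in> H" for b b' f f'
  proof -
    have "(b - b') mod int q = 0"
      using rotation subgroup.m_closed[OF H that] by (simp add: mult_dihedral_group)
    then have "b mod int q = b' mod int q" by (simp add: mod_eq_dvd_iff mod_eq_0_iff_dvd)
    then show ?thesis
      using subgroup.mem_carrier[OF H that(1)] subgroup.mem_carrier[OF H that(2)]
      by (auto simp: carrier_dihedral_group carrier_integer_mod_group)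
  qed
  show ?thesis
  proof (cases "\<exists>b f. ((b, True), f) \<in> H")
    case True
    then obtain b f where "((b, True), f) \<in> H" by blast
    with rotation reflection show ?thesis by (intro that[of b]) (auto split: if_splits)
  next
    case False
    \<comment> \<open>Without reflections the value of \<open>a\<close> is arbitrary.\<close>
    with rotation show ?thesis by (intro that[of 0]) (metis (full_types))
  qed
qed

lemma restrict_central_cocycle_trivial:
  assumes H: "subgroup H \<Gamma>" and card: "card H = 2 ^ m"
  shows "(restrict (central_cocycle 0) H, restrict (central_cocycle c) H)
    \<in> cocycle_rel (\<Gamma>\<lparr>carrier := H\<rparr>) HeisG (heis_act z)"
proof -
  obtain a where a: "\<And>b e f. ((b, e), f) \<in> H \<Longrightarrow> b = (if e then a else 0)"
    using two_subgroup_reflections[OF assms] by blast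
  obtain y where y: "y ^ 2 = c * z powi (- a)"
    using nth_root_exists[of 2 "c * z powi (- a)"] by auto
  \<comment> \<open>The reflections in \<open>H\<close> fix the superdiagonal
    \<open>(z powi a * y, y)\<close>, so only the corner \<open>z powi a * y ^ 2 = c\<close>
    survives. The other elements of \<open>H\<close> have exponent 0 and act trivially.\<close>
  define v where "v = unitri (z powi a * y) y 0"
  have c: "c = z powi a * (y * y)"
    using y z_nonzero by (simp add: power2_eq_square power_int_minus)
  have "central_cocycle c \<gamma> = v * central_cocycle 0 \<gamma> * heis_act z \<gamma> (inv\<^bsub>HeisG\<^esub> v)" if "\<gamma> \<in> H" for \<gamma>
  proof -
    obtain b e f where \<gamma>: "\<gamma> = ((b, e), f)" by (metis surj_pair)
    have "b = (if e then a else 0)" "\<gamma> \<in> carrier \<Gamma>"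
      using a that subgroup.mem_carrier[OF H that] unfolding \<gamma> by auto
    then show ?thesis
      using z_nonzero unfolding \<gamma> v_def
      by (simp add: central_cocycle_def heis_act_unitri unitri_mult inv_HeisG uminus_self add_self
          add_self_left power_int_minus c algebra_simps)
  qed
  moreover have "restrict (central_cocycle d) H \<in> Z1 (\<Gamma>\<lparr>carrier := H\<rparr>) HeisG (heis_act z)" for d
    by (rule res_H1_class(1)[OF group_HeisG acts_by_automorphisms_heis_act H central_cocycle_in_Z1])
  ultimately show ?thesis
    unfolding cocycle_rel_def HeisG_simps
    by (auto intro!: bexI[of _ v] simp: v_def)
qed

text \<open>The fibre is the one over the trivial class, represented by the restriction of
  \<open>central_cocycle 0\<close>; it contains a distinct class for each \<open>c\<close> in an
  infinite field.\<close>

lemma infinite_fibre: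
  assumes H: "subgroup H \<Gamma>" and card: "card H = 2 ^ m"
  shows "\<exists>y \<in> H1 (\<Gamma>\<lparr>carrier := H\<rparr>) HeisG (heis_act z).
    infinite {x \<in> H1 \<Gamma> HeisG (heis_act z). res_H1 \<Gamma> H HeisG (heis_act z) x = y}"
proof -
  note act = acts_by_automorphisms_heis_act
  note res = res_H1_class[OF group_HeisG act H central_cocycle_in_Z1]
  let ?R = "cocycle_rel \<Gamma> HeisG (heis_act z)"
  let ?R' = "cocycle_rel (\<Gamma>\<lparr>carrier := H\<rparr>) HeisG (heis_act z)"
  let ?y = "?R' `` {restrict (central_cocycle 0) H}"
  let ?cls = "\<lambda>c. ?R `` {central_cocycle c}"
  have "inj ?cls"
  proof (rule injI)
    fix c c' assume "?cls c = ?cls c'"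
    then have "(central_cocycle c, central_cocycle c') \<in> ?R"
      using eq_equiv_class[OF _ equiv_cocycle_rel[OF group_HeisG act] central_cocycle_in_Z1] by blast
    then show "c = c'" by (rule central_cocycle_rel_imp_eq)
  qed
  then have "infinite (range ?cls)"
    using infinite_alg_closed_field finite_imageD by blast
  moreover have "range ?cls \<subseteq> {x \<in> H1 \<Gamma> HeisG (heis_act z). res_H1 \<Gamma> H HeisG (heis_act z) x = ?y}"
  proof (intro subsetI CollectI conjI; elim rangeE; hypsubst)
    fix c
    show "?cls c \<in> H1 \<Gamma> HeisG (heis_act z)"
      unfolding H1_def by (rule quotientI) (rule central_cocycle_in_Z1)
    show "res_H1 \<Gamma> H HeisG (heis_act z) (?cls c) = ?y"
      unfolding res(2)
      by (rule equiv_class_eq[OF equiv_cocycle_rel[OF group_HeisG acts_by_automorphisms_subgroup[OF act H]]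
            restrict_central_cocycle_trivial[OF H card], symmetric])
  qed
  ultimately have "infinite {x \<in> H1 \<Gamma> HeisG (heis_act z). res_H1 \<Gamma> H HeisG (heis_act z) x = ?y}"
    using finite_subset by blast
  moreover have "?y \<in> H1 (\<Gamma>\<lparr>carrier := H\<rparr>) HeisG (heis_act z)"
    unfolding H1_def by (rule quotientI) (rule res(1))
  ultimately show ?thesis by blast
qed

end

theorem theorem1p3:
  fixes q :: nat
    and \<Gamma> :: "((int \<times> bool) \<times> int) monoid"
    and \<Gamma>\<^sub>2 :: "((int \<times> bool) \<times> int) set"
  assumes "CHAR('k::alg_closed_field) = 2"
    and "odd q" and "q > 3"
    and "\<Gamma> = dihedral_group q \<times>\<times> integer_mod_group 2"
    and "sylow_subgroup 2 \<Gamma> \<Gamma>\<^sub>2"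
  shows "\<exists>n (V :: 'k mat set) \<phi>.
    unipotent_group n V \<and> connectedin (zariski n) V \<and>
    acts_by_automorphisms \<Gamma> (GL n\<lparr>carrier := V\<rparr>) \<phi> \<and>
    (\<forall>\<gamma>\<in>carrier \<Gamma>. regular_map n V (\<phi> \<gamma>)) \<and>
    (\<exists>y \<in> H1 (\<Gamma>\<lparr>carrier := \<Gamma>\<^sub>2\<rparr>) (GL n\<lparr>carrier := V\<rparr>) \<phi>.
      infinite {x \<in> H1 \<Gamma> (GL n\<lparr>carrier := V\<rparr>) \<phi>.
        res_H1 \<Gamma> \<Gamma>\<^sub>2 (GL n\<lparr>carrier := V\<rparr>) \<phi> x = y})"
proof -
  obtain z :: 'k where z: "z ^ q = 1" "z \<noteq> 1"
    using exists_nontrivial_root_of_unity[OF assms(1,2)] assms(3) by auto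
  have q: "q > 1" using assms(3) by simp
  note hyps = assms(1,2) q z
  obtain m where "subgroup \<Gamma>\<^sub>2 \<Gamma>" "card \<Gamma>\<^sub>2 = 2 ^ m"
    using assms(5) unfolding sylow_subgroup_def by blast
  then have "\<exists>y \<in> H1 (\<Gamma>\<lparr>carrier := \<Gamma>\<^sub>2\<rparr>) HeisG (heis_act z).
      infinite {x \<in> H1 \<Gamma> HeisG (heis_act z). res_H1 \<Gamma> \<Gamma>\<^sub>2 HeisG (heis_act z) x = y}"
    unfolding assms(4) by (rule infinite_fibre[OF hyps])
  moreover have "acts_by_automorphisms \<Gamma> HeisG (heis_act z)"
    unfolding assms(4) by (rule acts_by_automorphisms_heis_act[OF hyps])
  moreover have "\<forall>\<gamma>\<in>carrier \<Gamma>. regular_map 3 Heis (heis_act z \<gamma>)"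
    by (metis regular_map_heis_act surj_pair)
  ultimately show ?thesis
    using unipotent_group_Heis connectedin_Heis[OF infinite_alg_closed_field] by blast
qed

end
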